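(* Let $G$ be a finite graph such that $\max(\alpha_M(G),\omega_M(G))\geq 2$. Then $$p(G)\leq\lceil\log_2(\max(\alpha_M(G),\omega_M(G))+1)\rceil.$$
   Context: Graphs are finite, simple and undirected. For $W\subseteq V(G)$, $G[W]$ is the induced subgraph. A subset $M\subseteq V(G)$ is a module of $G$ if every $v\in V(G)\setminus M$ is adjacent either to all vertices of $M$ or to none of them; the modules $\emptyset$, $V(G)$ and the singletons are trivial. A graph $G$ is prime if $|V(G)|\geq 4$ and all its modules are trivial. An extension of $G$ is a graph $H$ with $V(H)\supseteq V(G)$ and $H[V(G)]=G$; a $p$-extension is an extension with $|V(H)\setminus V(G)|=p$. The prime bound $p(G)$ is the smallest integer $p\ge 0$ such that $G$ admits a prime $p$-extension (such extensions exist whenever $|V(G)|\ge 2$). The modular clique number $\omega_M(G)$ is the largest size of a module of $G$ that is a clique in $G$; the modular stability number $\alpha_M(G)$ is the largest size of a module of $G$ that is a stable set in $G$. *)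

theory Defs
  imports
    Complex_Main
    "HOL-Library.Infinite_Typeclass"
    "Graph_Theory.Graph_Theory"
begin

text \<open>
  The finite simple undirected graphs are the \<^const>\<open>pair_graph\<close>s: finite,
  loop-free, with a symmetric set of arcs, so that \<open>x\<close> and \<open>y\<close> are adjacent
  in \<open>G\<close> iff \<open>(x, y) \<in> parcs G\<close>.
\<close>

definition graph_module :: "'a pair_pre_digraph \<Rightarrow> 'a set \<Rightarrow> bool" where
  "graph_module G M \<longleftrightarrow> M \<subseteq> pverts G \<and>
     (\<forall>v \<in> pverts G - M. (\<forall>x \<in> M. (v, x) \<in> parcs G) \<or> (\<forall>x \<in> M. (v, x) \<notin> parcs G))"

definition trivial_module :: "'a pair_pre_digraph \<Rightarrow> 'a set \<Rightarrow> bool" where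
  "trivial_module G M \<longleftrightarrow> M = {} \<or> M = pverts G \<or> (\<exists>v \<in> pverts G. M = {v})"

definition prime_graph :: "'a pair_pre_digraph \<Rightarrow> bool" where
  "prime_graph G \<longleftrightarrow> card (pverts G) \<ge> 4 \<and> (\<forall>M. graph_module G M \<longrightarrow> trivial_module G M)"

definition graph_extension :: "'a pair_pre_digraph \<Rightarrow> 'a pair_pre_digraph \<Rightarrow> bool" where
  "graph_extension G H \<longleftrightarrow>
     pair_graph H \<and> pverts G \<subseteq> pverts H \<and> with_proj H \<restriction> pverts G = with_proj G"

definition p_extension :: "nat \<Rightarrow> 'a pair_pre_digraph \<Rightarrow> 'a pair_pre_digraph \<Rightarrow> bool" where
  "p_extension p G H \<longleftrightarrow> graph_extension G H \<and> card (pverts H - pverts G) = p"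

text \<open>
  An extension has the same vertex type as \<open>G\<close>; the class \<^class>\<open>infinite\<close>
  guarantees that new vertices are always available, so that every extension of the
  finite graph \<open>G\<close> is present up to isomorphism over \<open>G\<close>.
\<close>

definition prime_bound :: "'a::infinite pair_pre_digraph \<Rightarrow> nat" where
  "prime_bound G = (LEAST p. \<exists>H. p_extension p G H \<and> prime_graph H)"

definition clique_set :: "'a pair_pre_digraph \<Rightarrow> 'a set \<Rightarrow> bool" where
  "clique_set G W \<longleftrightarrow> W \<subseteq> pverts G \<and> (\<forall>x \<in> W. \<forall>y \<in> W. x \<noteq> y \<longrightarrow> (x, y) \<in> parcs G)"

definition stable_set :: "'a pair_pre_digraph \<Rightarrow> 'a set \<Rightarrow> bool" where
  "stable_set G W \<longleftrightarrow> W \<subseteq> pverts G \<and> (\<forall>x \<in> W. \<forall>y \<in> W. x \<noteq> y \<longrightarrow> (x, y) \<notin> parcs G)"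

definition modular_clique_number :: "'a pair_pre_digraph \<Rightarrow> nat" where
  "modular_clique_number G = Max (card ` {M. graph_module G M \<and> clique_set G M})"

definition modular_stability_number :: "'a pair_pre_digraph \<Rightarrow> nat" where
  "modular_stability_number G = Max (card ` {M. graph_module G M \<and> stable_set G M})"

end

theory Submission
  imports Defs
begin

text \<open>
  Passing to the complement if necessary, a largest clique or stable module is stable.
  Add a stable set \<open>S\<close> of \<open>k\<close> new vertices, where \<open>m < 2 ^ k\<close> for the
  maximum \<open>m\<close>, and describe the extension by the colour \<open>f v \<subseteq> S\<close> of each old
  vertex \<open>v\<close>, its set of new neighbours. A module of the extension avoiding \<open>S\<close>
  is a module of \<open>G\<close> with constant colour. A minimal module with at least two
  elements is either a pair of twins or has at least three elements (a block), and blocks are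
  pairwise disjoint and disjoint from nontrivial twin classes. So it suffices to colour each twin
  class injectively and each block nonconstantly. Each twin class is a clique or stable module and
  hence has fewer than \<open>2 ^ k\<close> elements, which leaves one colour to spare: stable classes
  avoid the empty colour and clique classes avoid \<open>S\<close>. Together with a few prescribed
  colours, in particular \<open>{a}\<close> and all \<open>{a, c}\<close> on a largest class, this excludes
  the nontrivial modules meeting \<open>S\<close>.
\<close>

text \<open>Serves to colour one twin class \<open>D\<close> with admissible colours
  \<open>A\<close> so that all prescribed colours \<open>R\<close> occur: any set of size
  \<open>card D\<close> between \<open>R\<close> and \<open>A\<close> can be the image.\<close>

lemma exists_inj_on_covering:
  assumes "finite D" "finite A" "R \<subseteq> A" "card R \<le> card D" "card D \<le> card A"
  shows "\<exists>g. inj_on g D \<and> g ` D \<subseteq> A \<and> R \<subseteq> g ` D"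
proof -
  have "\<exists>B. R \<subseteq> B \<and> B \<subseteq> A \<and> card B = card D"
    using assms exists_subset_between[of R "card D" A] by blast
  then obtain B where B: "R \<subseteq> B" "B \<subseteq> A" "card B = card D" by blast
  moreover have "finite B" using B assms finite_subset by blast
  ultimately obtain g where "bij_betw g D B"
    using assms(1) finite_same_card_bij by metis
  thus ?thesis using B unfolding bij_betw_def by blast
qed

section \<open>Modules, twins and blocks\<close>

text \<open>
  The relation need not be irreflexive, since modules ignore the diagonal; hence the locale is
  closed under complementation.
\<close>

locale symmetric_relation =
  fixes V :: "'a set" and E :: "'a \<Rightarrow> 'a \<Rightarrow> bool"
  assumes finite_V: "finite V" and sym: "E x y \<longleftrightarrow> E y x"
begin

definition rel_module :: "'a set \<Rightarrow> bool" where
  "rel_module M \<longleftrightarrow> M \<subseteq> V \<and> (\<forall>v \<in> V - M. (\<forall>x \<in> M. E v x) \<or> (\<forall>x \<in> M. \<not> E v x))"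

text \<open>Adjacency between \<open>x\<close> and \<open>y\<close> themselves is left open, so
  stable and clique pairs fall under one notion.\<close>

definition twins :: "'a \<Rightarrow> 'a \<Rightarrow> bool" where
  "twins x y \<longleftrightarrow> (\<forall>v \<in> V - {x, y}. E v x \<longleftrightarrow> E v y)"

definition twin_class :: "'a \<Rightarrow> 'a set" where
  "twin_class x = {y \<in> V. twins x y}"

text \<open>Minimal among the modules with at least two elements; size two is left out because those
  modules are pairs of twins.\<close>

definition block :: "'a set \<Rightarrow> bool" where
  "block P \<longleftrightarrow> rel_module P \<and> card P \<ge> 3 \<and> (\<forall>N. rel_module N \<and> N \<subset> P \<longrightarrow> card N \<le> 1)"

lemma rel_moduleD: "rel_module M \<Longrightarrow> v \<in> V \<Longrightarrow> v \<notin> M \<Longrightarrow> x \<in> M \<Longrightarrow> y \<in> M \<Longrightarrow> E v x \<longleftrightarrow> E v y"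
  unfolding rel_module_def by blast

lemma rel_moduleI:
  assumes "M \<subseteq> V" "\<And>v x y. v \<in> V \<Longrightarrow> v \<notin> M \<Longrightarrow> x \<in> M \<Longrightarrow> y \<in> M \<Longrightarrow> E v x \<Longrightarrow> E v y"
  shows "rel_module M"
  unfolding rel_module_def using assms by blast

lemma rel_module_finite: "rel_module M \<Longrightarrow> finite M"
  unfolding rel_module_def using finite_V finite_subset by blast

section \<open>Twin classes\<close>

lemma twins_refl: "twins x x"
  unfolding twins_def by blast

lemma twins_sym: "twins x y \<Longrightarrow> twins y x"
  unfolding twins_def by blast

lemma twinsD: "twins x y \<Longrightarrow> v \<in> V \<Longrightarrow> v \<noteq> x \<Longrightarrow> v \<noteq> y \<Longrightarrow> E v x \<longleftrightarrow> E v y"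
  unfolding twins_def by simp

lemma twins_trans:
  assumes "twins x y" "twins y z" "x \<in> V" "y \<in> V" "z \<in> V"
  shows "twins x z"
  unfolding twins_def
proof
  fix v assume v: "v \<in> V - {x, z}"
  show "E v x \<longleftrightarrow> E v z"
  \<comment> \<open>The middle vertex \<open>y\<close> is the only one not covered by chaining the
    hypotheses; there \<open>E y x\<close> and \<open>E y z\<close> both agree with
    \<open>E x z\<close>.\<close>
  proof (cases "v = y \<and> x \<noteq> z")
    case True
    have "E z x \<longleftrightarrow> E z y" "E x y \<longleftrightarrow> E x z"
      using True v twinsD[OF assms(1), of z] twinsD[OF assms(2), of x] assms(3-5) by auto
    then show ?thesis using True sym[of y x] sym[of x z] sym[of z y] by simp
  next
    case False
    then show ?thesis using v twinsD[OF assms(1), of v] twinsD[OF assms(2), of v] by auto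
  qed
qed

lemma twin_class_subset: "twin_class x \<subseteq> V"
  unfolding twin_class_def by blast

lemma twin_class_self: "x \<in> V \<Longrightarrow> x \<in> twin_class x"
  unfolding twin_class_def using twins_refl by blast

lemma finite_twin_class: "finite (twin_class x)"
  using twin_class_subset finite_V finite_subset by blast

lemma twin_class_twins:
  assumes "x \<in> V" "y \<in> twin_class x" "z \<in> twin_class x"
  shows "twins y z"
  using assms twins_trans[of y x z] twins_sym[of x y] unfolding twin_class_def by simp

lemma twin_class_eq:
  assumes "x \<in> V" "y \<in> twin_class x"
  shows "twin_class y = twin_class x"
  using assms twins_trans[of x y] twins_trans[of y x] twins_sym[of x y]
  unfolding twin_class_def by auto

lemma twin_class_adjacent:
  assumes "x \<in> V" "y \<in> twin_class x" "z \<in> twin_class x" "v \<in> V" "v \<noteq> y" "v \<noteq> z"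
  shows "E v y \<longleftrightarrow> E v z"
  using twinsD[OF twin_class_twins[OF assms(1-3)]] assms(4-6) by simp

lemma twin_class_module:
  assumes "x \<in> V"
  shows "rel_module (twin_class x)"
proof (rule rel_moduleI)
  fix v y z assume "v \<in> V" "v \<notin> twin_class x" "y \<in> twin_class x" "z \<in> twin_class x" "E v y"
  then show "E v z" using twin_class_adjacent[OF assms, of y z v] by blast
qed (rule twin_class_subset)

text \<open>Replacing one end of a pair by a twin keeps adjacency, so changing one end at a time
  shows that all pairs of distinct members agree.\<close>

lemma twin_class_stable_or_clique:
  assumes "x \<in> V"
  shows "(\<forall>y \<in> twin_class x. \<forall>z \<in> twin_class x. y \<noteq> z \<longrightarrow> \<not> E y z) \<or>
         (\<forall>y \<in> twin_class x. \<forall>z \<in> twin_class x. y \<noteq> z \<longrightarrow> E y z)"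
proof -
  have "E y z \<longleftrightarrow> E y' z'"
    if "y \<in> twin_class x" "z \<in> twin_class x" "y' \<in> twin_class x" "z' \<in> twin_class x"
      "y \<noteq> z" "y' \<noteq> z'" for y z y' z'
    using that twin_class_adjacent[OF assms] twin_class_subset[of x] sym
    by (metis subsetD)
  then show ?thesis by blast
qed

section \<open>Blocks and their intersections\<close>

text \<open>A second element \<open>w\<close> of \<open>Q\<close> would make \<open>P - {x}\<close>
  a module with at least two elements, against the minimality of \<open>P\<close>.\<close>

lemma block_inter_module:
  assumes "block P" "rel_module Q" "P \<inter> Q = {x}" "w \<in> Q"
  shows "w = x"
proof (rule ccontr)
  assume "w \<noteq> x"
  have P: "rel_module P" "card P \<ge> 3" "x \<in> P" "P \<subseteq> V" "w \<notin> P" "w \<in> V" "x \<in> Q"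
    using assms \<open>w \<noteq> x\<close> unfolding block_def rel_module_def by auto
  have "rel_module (P - {x})"
  proof (rule rel_moduleI)
    show "P - {x} \<subseteq> V" using P by blast
    fix v y z assume v: "v \<in> V" "v \<notin> P - {x}" "y \<in> P - {x}" "z \<in> P - {x}" "E v y"
    show "E v z"
    \<comment> \<open>Since \<open>Q\<close> is a module, \<open>x\<close> treats
      \<open>P - {x}\<close> as \<open>w\<close> does, and \<open>w\<close> lies outside the module
      \<open>P\<close>.\<close>
    proof (cases "v = x")
      case True
      have "y \<notin> Q" "z \<notin> Q" using v assms(3) by blast+
      then have "E y x \<longleftrightarrow> E y w" "E z x \<longleftrightarrow> E z w"
        using rel_moduleD[OF assms(2)] v P assms(4) by blast+
      moreover have "E w y \<longleftrightarrow> E w z" using rel_moduleD[OF P(1)] P v by blast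
      ultimately show ?thesis using True v sym by metis
    next
      case False
      then show ?thesis using rel_moduleD[OF P(1)] v by blast
    qed
  qed
  moreover have "P - {x} \<subset> P" using P by blast
  ultimately have "card (P - {x}) \<le> 1" using assms(1) unfolding block_def by blast
  then show False using P by simp
qed

lemma twins_module: "x \<in> V \<Longrightarrow> y \<in> V \<Longrightarrow> twins x y \<Longrightarrow> rel_module {x, y}"
  unfolding rel_module_def twins_def by auto

text \<open>A twin \<open>y\<close> of \<open>x\<close> gives the module \<open>{x, y}\<close>,
  which is either too small a module inside \<open>P\<close> or meets \<open>P\<close> in
  \<open>x\<close> alone.\<close>

lemma block_twin_class:
  assumes "block P" "x \<in> P"
  shows "twin_class x = {x}"
proof -
  have x: "x \<in> V" using assms unfolding block_def rel_module_def by blast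
  have "y = x" if "y \<in> twin_class x" for y
  proof (rule ccontr)
    assume "y \<noteq> x"
    have m: "rel_module {x, y}" using that x twins_module unfolding twin_class_def by blast
    show False
    proof (cases "y \<in> P")
      case True
      have "{x, y} \<noteq> P" using assms(1) \<open>y \<noteq> x\<close> unfolding block_def by auto
      then have "card {x, y} \<le> 1" using True assms m unfolding block_def by blast
      then show False using \<open>y \<noteq> x\<close> by simp
    next
      case False
      then have "P \<inter> {x, y} = {x}" using assms by blast
      then show False using block_inter_module[OF assms(1) m] \<open>y \<noteq> x\<close> by blast
    qed
  qed
  then show ?thesis using twin_class_self[OF x] by blast
qed

text \<open>The intersection is a module and proper in one of two distinct blocks, so minimality
  reduces it to \<open>{x}\<close>; then \<open>block_inter_module\<close> collapses
  \<open>Q\<close>.\<close>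

lemma blocks_disjoint:
  assumes "block P" "block Q" "x \<in> P" "x \<in> Q"
  shows "P = Q"
proof (rule ccontr)
  assume ne: "P \<noteq> Q"
  have mod: "rel_module P" "rel_module Q" using assms unfolding block_def by blast+
  have int: "rel_module (P \<inter> Q)"
  proof (rule rel_moduleI)
    show "P \<inter> Q \<subseteq> V" using mod unfolding rel_module_def by blast
    fix v y z assume "v \<in> V" "v \<notin> P \<inter> Q" "y \<in> P \<inter> Q" "z \<in> P \<inter> Q" "E v y"
    then show "E v z" using rel_moduleD[OF mod(1)] rel_moduleD[OF mod(2)] by blast
  qed
  have "P \<inter> Q \<subset> P \<or> P \<inter> Q \<subset> Q" using ne by blast
  then have "card (P \<inter> Q) \<le> 1" using int assms unfolding block_def by blast
  then have "\<forall>y \<in> P \<inter> Q. \<forall>z \<in> P \<inter> Q. y = z"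
    using card_le_Suc0_iff_eq[OF rel_module_finite[OF int]] by simp
  then have "P \<inter> Q = {x}" using assms(3,4) by blast
  then have "Q \<subseteq> {x}" using block_inter_module[OF assms(1) mod(2)] by blast
  then have "card Q \<le> 1" using card_mono[of "{x}" Q] by simp
  then show False using assms(2) unfolding block_def by simp
qed

text \<open>If \<open>p\<close> were isolated inside \<open>P\<close>, then \<open>P - {p}\<close>
  would be a module. The neighbour is later the vertex of colour \<open>{b}\<close> next to one of
  colour \<open>{a}\<close>.\<close>

lemma block_neighbour:
  assumes "block P" "p \<in> P"
  shows "\<exists>q \<in> P. q \<noteq> p \<and> E q p"
proof (rule ccontr)
  assume no: "\<not> (\<exists>q \<in> P. q \<noteq> p \<and> E q p)"
  have P: "rel_module P" "card P \<ge> 3" "P \<subseteq> V"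
    using assms unfolding block_def rel_module_def by blast+
  have "rel_module (P - {p})"
  proof (rule rel_moduleI)
    show "P - {p} \<subseteq> V" using P by blast
    fix v y z assume v: "v \<in> V" "v \<notin> P - {p}" "y \<in> P - {p}" "z \<in> P - {p}" "E v y"
    then have "v \<noteq> p" using no sym by blast
    then show "E v z" using rel_moduleD[OF P(1)] v by blast
  qed
  moreover have "P - {p} \<subset> P" using assms by blast
  ultimately have "card (P - {p}) \<le> 1" using assms(1) unfolding block_def by blast
  then show False using P assms by simp
qed

text \<open>Among the modules inside \<open>M\<close> with at least two elements, one of least size
  is a twin pair or a block.\<close>

lemma module_contains_twins_or_block:
  assumes "rel_module M" "card M \<ge> 2"
  shows "(\<exists>x \<in> M. \<exists>y \<in> M. x \<noteq> y \<and> twins x y) \<or> (\<exists>P \<subseteq> M. block P)"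
proof -
  let ?Q = "\<lambda>N. rel_module N \<and> N \<subseteq> M \<and> card N \<ge> 2"
  obtain N where N: "?Q N" "\<And>N'. ?Q N' \<Longrightarrow> card N \<le> card N'"
    using ex_has_least_nat[of ?Q M card] assms by blast
  have fin: "finite N" using N rel_module_finite by blast
  show ?thesis
  proof (cases "card N = 2")
    case True
    then obtain x y where xy: "N = {x, y}" "x \<noteq> y" by (meson card_2_iff)
    then have "twins x y" using N unfolding twins_def rel_module_def by auto
    then show ?thesis using xy N by blast
  next
    case False
    have "block N" unfolding block_def
    proof (intro conjI allI impI)
      fix N' assume N': "rel_module N' \<and> N' \<subset> N"
      then have "card N' < card N" using fin psubset_card_mono by blast
      then show "card N' \<le> 1" using N(2)[of N'] N' N(1) by (metis Suc_1 leD not_less_eq_eq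
            psubset_imp_subset subset_trans)
    qed (use N False in auto)
    then show ?thesis using N by blast
  qed
qed

end

section \<open>Extending by a stable set\<close>

text \<open>\<open>class_inj\<close> and \<open>block_nonconstant\<close> exclude modules inside
  \<open>V\<close>, and the colours \<open>{a}\<close> and \<open>{a, c}\<close> on \<open>C\<close>
  exclude modules inside \<open>S\<close>. Modules meeting both need the remaining class conditions
  as well.\<close>

locale coloured_relation = symmetric_relation V E
  for V :: "'a set" and E :: "'a \<Rightarrow> 'a \<Rightarrow> bool" +
  fixes S :: "'a set" and a b :: 'a and C :: "'a set" and f :: "'a \<Rightarrow> 'a set"
  assumes disj: "V \<inter> S = {}" and ab: "a \<in> S" "b \<in> S" "a \<noteq> b"
    and fS: "f x \<subseteq> S"
    and C_V: "C \<subseteq> V" and C_mod: "rel_module C"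
    and C_stable: "x \<in> C \<Longrightarrow> y \<in> C \<Longrightarrow> x \<noteq> y \<Longrightarrow> \<not> E x y"
    and C_a: "\<exists>x \<in> C. f x = {a}" and C_ac: "c \<in> S \<Longrightarrow> c \<noteq> a \<Longrightarrow> \<exists>x \<in> C. f x = {a, c}"
    and class_inj: "x \<in> V \<Longrightarrow> y \<in> V \<Longrightarrow> twins x y \<Longrightarrow> f x = f y \<Longrightarrow> x = y"
    and class_stable: "x \<in> V \<Longrightarrow> y \<in> V \<Longrightarrow> twins x y \<Longrightarrow> x \<noteq> y \<Longrightarrow> \<not> E x y \<Longrightarrow>
        f x \<noteq> {} \<and> (\<exists>z \<in> V. twins x z \<and> f z = {a, b})"
    and class_clique: "x \<in> V \<Longrightarrow> y \<in> V \<Longrightarrow> twins x y \<Longrightarrow> x \<noteq> y \<Longrightarrow> E x y \<Longrightarrow>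
        f x \<noteq> S \<and> (\<exists>z \<in> V. twins x z \<and> f z = {b})"
    and class_single: "x \<in> V \<Longrightarrow> (\<And>y. y \<in> V \<Longrightarrow> twins x y \<Longrightarrow> y = x) \<Longrightarrow>
        f x = {b} \<or> f x = {a} \<and> (\<exists>q \<in> V. q \<noteq> x \<and> E q x \<and> f q = {b})"
    and block_nonconstant: "block P \<Longrightarrow> \<exists>x \<in> P. \<exists>y \<in> P. f x \<noteq> f y"
begin

definition ext :: "'a \<Rightarrow> 'a \<Rightarrow> bool" where
  "ext x y \<longleftrightarrow> x \<in> V \<and> y \<in> V \<and> E x y \<or> x \<in> V \<and> y \<in> f x \<and> y \<in> S \<or> y \<in> V \<and> x \<in> f y \<and> x \<in> S"

lemma ext_sym: "ext x y \<longleftrightarrow> ext y x"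
  unfolding ext_def using sym[of x y] by auto

lemma ext_VV: "x \<in> V \<Longrightarrow> y \<in> V \<Longrightarrow> ext x y \<longleftrightarrow> E x y"
  unfolding ext_def using disj by auto

lemma ext_VS: "x \<in> V \<Longrightarrow> y \<in> S \<Longrightarrow> ext x y \<longleftrightarrow> y \<in> f x"
  unfolding ext_def using disj by auto

lemma ext_SV: "x \<in> S \<Longrightarrow> y \<in> V \<Longrightarrow> ext x y \<longleftrightarrow> x \<in> f y"
  unfolding ext_def using disj by auto

lemma ext_SS: "x \<in> S \<Longrightarrow> y \<in> S \<Longrightarrow> \<not> ext x y"
  unfolding ext_def using disj by auto

section \<open>Modules of the extension: inside \<open>V\<close>, inside \<open>S\<close>, or
  meeting both\<close>

context
  fixes M
  assumes M_sub: "M \<subseteq> V \<union> S"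
    and M_ext: "\<forall>v \<in> V \<union> S - M. (\<forall>x \<in> M. ext v x) \<or> (\<forall>x \<in> M. \<not> ext v x)"
begin

lemma M_mod: "v \<in> V \<union> S \<Longrightarrow> v \<notin> M \<Longrightarrow> x \<in> M \<Longrightarrow> y \<in> M \<Longrightarrow> ext v x \<Longrightarrow> ext v y"
  using M_ext by blast

lemma trace_module: "rel_module (M \<inter> V)"
proof (rule rel_moduleI)
  fix v x y assume "v \<in> V" "v \<notin> M \<inter> V" "x \<in> M \<inter> V" "y \<in> M \<inter> V" "E v x"
  then show "E v y" using M_mod[of v x y] ext_VV by blast
qed blast

text \<open>All of \<open>S\<close> lies outside \<open>M\<close>, so \<open>f\<close> is constant
  on \<open>M\<close>, whereas a twin pair or a block in \<open>M\<close> carries two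
  colours.\<close>

lemma module_within_V:
  assumes "M \<subseteq> V" "finite M"
  shows "card M \<le> 1"
proof (rule ccontr)
  assume "\<not> card M \<le> 1"
  moreover have "rel_module M" using trace_module assms by (simp add: Int_absorb2)
  ultimately consider x y where "x \<in> M" "y \<in> M" "x \<noteq> y" "twins x y" | P where "P \<subseteq> M" "block P"
    using module_contains_twins_or_block[of M] by force
  then obtain x y where xy: "x \<in> M" "y \<in> M" "f x \<noteq> f y"
  proof cases
    case 1 then show ?thesis using that class_inj assms by blast
  next
    case 2 then show ?thesis using that block_nonconstant by blast
  qed
  have "c \<in> f y" if "c \<in> f x" "x \<in> M" "y \<in> M" for c x y
  proof -
    have "c \<in> S" using that fS by blast
    then show ?thesis using M_mod[of c x y] that assms disj ext_SV by blast
  qed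
  then show False using xy by blast
qed

lemma outer_V_S_S:
  assumes "v \<in> V" "v \<notin> M" "c \<in> M" "c \<in> S" "d \<in> M" "d \<in> S" "c \<in> f v"
  shows "d \<in> f v"
  using M_mod[of v c d] assms by (simp add: ext_VS)

lemma outer_V_V_S:
  assumes "v \<in> V" "v \<notin> M" "w \<in> M" "w \<in> V" "c \<in> M" "c \<in> S"
  shows "E v w \<longleftrightarrow> c \<in> f v"
  using M_mod[of v c w] M_mod[of v w c] assms by (auto simp: ext_VS ext_VV)

text \<open>The vertices of \<open>C\<close> lie outside \<open>M\<close>. Colour \<open>{a}\<close>
  separates \<open>a\<close> from the rest of \<open>S\<close>, and \<open>{a, c}\<close> separates
  \<open>c\<close> from everything but \<open>a\<close>.\<close>

lemma module_within_S:
  assumes "M \<subseteq> S" "s \<in> M" "t \<in> M"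
  shows "s = t"
proof -
  have *: "c = t" if c: "c \<in> M" "t \<in> M" "c \<noteq> a" for c t
  proof (cases "t = a")
    case True
    obtain x where "x \<in> C" "f x = {a}" using C_a by blast
    moreover from this have "x \<in> V" "x \<notin> M" using C_V disj assms(1) by blast+
    ultimately show ?thesis using outer_V_S_S[of x t c] that True assms(1) by auto
  next
    case False
    obtain x where "x \<in> C" "f x = {a, c}" using C_ac[of c] c assms(1) by auto
    moreover from this have "x \<in> V" "x \<notin> M" using C_V disj assms(1) by blast+
    ultimately show ?thesis using outer_V_S_S[of x c t] that False assms(1) by auto
  qed
  then show ?thesis using assms(2,3) by blast
qed

text \<open>If \<open>t\<close> saw \<open>v\<close>, it would see \<open>s\<close> too, but
  \<open>S\<close> is stable.\<close>

lemma nonneighbour_S: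
  assumes "s \<in> M" "s \<in> S" "t \<in> S" "t \<notin> M" "v \<in> M" "v \<in> V"
  shows "t \<notin> f v"
  using M_mod[of t v s] assms by (auto simp: ext_SV ext_SS)

text \<open>Otherwise \<open>a\<close> is the only element of \<open>S\<close> in \<open>M\<close>,
  and the colours near \<open>v\<close> contradict this.\<close>

lemma module_meets_C:
  assumes "s \<in> M" "s \<in> S" "v \<in> M" "v \<in> V"
  shows "C \<inter> M \<noteq> {}"
proof
  assume CM: "C \<inter> M = {}"
  have "\<exists>x \<in> C. s \<in> f x" using C_a C_ac[OF assms(2)] by (cases "s = a") auto
  then obtain x where x: "x \<in> C" "s \<in> f x" by blast
  \<comment> \<open>\<open>x\<close> lies outside \<open>M\<close> and sees \<open>s\<close>, hence
    all of \<open>M\<close>; as \<open>C\<close> is a module, every vertex of \<open>C\<close> then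
    sees all of \<open>M \<inter> V\<close>.\<close>
  have xE: "E x w" if "w \<in> M" "w \<in> V" for w
    using outer_V_V_S[of x w s] x CM that assms C_V by blast
  have yE: "E y w" if "y \<in> C" "w \<in> M" "w \<in> V" for y w
    using rel_moduleD[OF C_mod, of w x y] xE that x CM sym by blast
  obtain y where y: "y \<in> C" "f y = {a}" using C_a by blast
  \<comment> \<open>The vertex \<open>y\<close> of colour \<open>{a}\<close> sees \<open>v\<close>,
    hence every element of \<open>M \<inter> S\<close>.\<close>
  have Ma: "t = a" if "t \<in> M" "t \<in> S" for t
    using outer_V_V_S[of y v t] y that yE[of y v] assms C_V CM by blast
  then have a: "a \<in> M" and b: "b \<notin> M" using assms ab by blast+
  have fa: "f w \<subseteq> {a}" if "w \<in> M" "w \<in> V" for w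
    using nonneighbour_S[OF a ab(1)] that Ma fS by blast
  \<comment> \<open>Each case below violates this equivalence by a vertex whose colour contains
    \<open>b\<close>, which puts it outside \<open>M\<close>: a neighbour of \<open>v\<close> of
    colour \<open>{b}\<close>, or a nonadjacent twin of colour \<open>{a, b}\<close>.\<close>
  have not_adj_a: "a \<notin> f w \<longleftrightarrow> \<not> E w v" if "w \<in> V" "w \<notin> M" for w
    using outer_V_V_S[of w v a] that assms a ab by blast
  show False
  proof (cases "\<exists>u \<in> V. twins v u \<and> u \<noteq> v")
    case False
    then have "f v = {a} \<and> (\<exists>q \<in> V. q \<noteq> v \<and> E q v \<and> f q = {b})"
      using class_single[OF assms(4)] fa[OF assms(3,4)] ab by blast
    then obtain q where "q \<in> V" "E q v" "f q = {b}" by blast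
    then show False using not_adj_a[of q] fa[of q] ab by blast
  next
    case True
    then obtain u where u: "u \<in> V" "twins v u" "u \<noteq> v" by blast
    show False
    proof (cases "E v u")
      case True
      then obtain z where z: "z \<in> V" "twins v z" "f z = {b}"
        using class_clique[OF assms(4) u(1,2)] u by blast
      then have "z \<notin> M" using fa ab by blast
      moreover have "E z v"
      proof -
        have "u \<in> twin_class v" "z \<in> twin_class v" "z \<noteq> v"
          using u z assms(3) \<open>z \<notin> M\<close> unfolding twin_class_def by blast+
        then show ?thesis
          using True twin_class_stable_or_clique[OF assms(4)] twin_class_self[OF assms(4)] u by metis
      qed
      ultimately show False using not_adj_a z ab by blast
    next
      case False
      then obtain z where z: "z \<in> V" "twins v z" "f z = {a, b}"
        using class_stable[OF assms(4) u(1,2)] u by blast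
      then have "z \<notin> M" using fa ab by blast
      moreover have "\<not> E z v"
      proof -
        have "u \<in> twin_class v" "z \<in> twin_class v" "z \<noteq> v"
          using u z assms(3) \<open>z \<notin> M\<close> unfolding twin_class_def by blast+
        then show ?thesis
          using False twin_class_stable_or_clique[OF assms(4)] twin_class_self[OF assms(4)] u by metis
      qed
      ultimately show False using not_adj_a z ab by blast
    qed
  qed
qed

lemma module_contains_S:
  assumes "s \<in> M" "s \<in> S" "v \<in> M" "v \<in> V"
  shows "S \<subseteq> M"
proof (rule ccontr)
  assume "\<not> S \<subseteq> M"
  then obtain t where t: "t \<in> S" "t \<notin> M" by blast
  obtain x where x: "x \<in> C" "x \<in> M" using module_meets_C[OF assms] by blast
  \<comment> \<open>No colour on \<open>C\<close> may mix elements of \<open>S\<close> inside and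
    outside \<open>M\<close>: if \<open>y\<close> is in \<open>M\<close>, \<open>q\<close> must not
    see it; if not, \<open>y\<close> sees \<open>p\<close> but not \<open>x\<close>.\<close>
  have *: False if "y \<in> C" "p \<in> f y" "q \<in> f y" "p \<in> S" "q \<in> S" "p \<in> M" "q \<notin> M" for y p q
  proof (cases "y \<in> M")
    case True
    then show False using nonneighbour_S that C_V by blast
  next
    case False
    then have "y \<noteq> x" using x by blast
    then have "\<not> E y x" using C_stable that x by blast
    then show False using outer_V_V_S[of y x p] False that x C_V by blast
  qed
  show False
  proof (cases "a \<in> M")
    case True
    then obtain y where "y \<in> C" "f y = {a, t}" using C_ac[of t] t by auto
    then show False using *[of y a t] True t ab by blast
  next
    case False
    then obtain y where "y \<in> C" "f y = {a, s}" using C_ac[of s] assms by auto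
    then show False using *[of y s a] False assms ab by blast
  qed
qed

text \<open>Once \<open>S \<subseteq> M\<close>, a vertex of \<open>V\<close> outside
  \<open>M\<close> has colour \<open>S\<close> or \<open>{}\<close>, according to its adjacency to
  \<open>M \<inter> V\<close>; the class conditions rule this out.\<close>

lemma module_mixed:
  assumes "s \<in> M" "s \<in> S" "v \<in> M" "v \<in> V"
  shows "M = V \<union> S"
proof -
  have SM: "S \<subseteq> M" using module_contains_S[OF assms] .
  have full: "f u = S" if "u \<in> V" "u \<notin> M" "w \<in> M" "w \<in> V" "E u w" for u w
  proof -
    have "c \<in> f u" if "c \<in> S" for c
      using outer_V_V_S[OF \<open>u \<in> V\<close> \<open>u \<notin> M\<close> \<open>w \<in> M\<close> \<open>w \<in> V\<close>, of c] that SM \<open>E u w\<close> by blast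
    then show ?thesis using fS[of u] by blast
  qed
  have empty: "f u = {}" if "u \<in> V" "u \<notin> M" "w \<in> M" "w \<in> V" "\<not> E u w" for u w
  proof -
    have "c \<notin> f u" if "c \<in> S" for c
      using outer_V_V_S[OF \<open>u \<in> V\<close> \<open>u \<notin> M\<close> \<open>w \<in> M\<close> \<open>w \<in> V\<close>, of c] that SM \<open>\<not> E u w\<close> by blast
    then show ?thesis using fS[of u] by blast
  qed
  have "u \<in> M" if u: "u \<in> V" for u
  proof (rule ccontr)
    assume uM: "u \<notin> M"
    have "f u = S \<or> f u = {}" using full[OF u uM assms(3,4)] empty[OF u uM assms(3,4)] by metis
    \<comment> \<open>\<open>S\<close> contains both \<open>a\<close> and \<open>b\<close>, so it is
      no singleton; hence \<open>u\<close> has a proper twin.\<close>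
    then have "f u \<noteq> {a}" "f u \<noteq> {b}" using ab by auto
    then obtain w where w: "w \<in> V" "twins u w" "w \<noteq> u"
      using class_single[OF u] by metis
    show False
    proof (cases "w \<in> M")
      case True
      then show False using full[OF u uM True w(1)] empty[OF u uM True w(1)]
          class_clique[OF u w(1,2)] class_stable[OF u w(1,2)] w(3) by metis
    next
      case False
      \<comment> \<open>Twins outside \<open>M\<close> relate to \<open>v\<close> alike, so they
        would share a colour.\<close>
      have "E v u \<longleftrightarrow> E v w" using w(2) assms uM False unfolding twins_def by blast
      then have "E u v \<longleftrightarrow> E w v" using sym by blast
      then have "f u = f w"
        using full[OF u uM assms(3,4)] empty[OF u uM assms(3,4)]
          full[OF w(1) False assms(3,4)] empty[OF w(1) False assms(3,4)] by metis
      then show False using class_inj u w by blast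
    qed
  qed
  then show ?thesis using SM M_sub by blast
qed

end

lemma ext_module_trivial:
  assumes "finite S" "M \<subseteq> V \<union> S"
    and "\<forall>v \<in> V \<union> S - M. (\<forall>x \<in> M. ext v x) \<or> (\<forall>x \<in> M. \<not> ext v x)"
  shows "M = {} \<or> M = V \<union> S \<or> (\<exists>v \<in> V \<union> S. M = {v})"
proof -
  have fin: "finite M" using assms finite_V finite_subset by blast
  consider "M \<subseteq> V" | "M \<subseteq> S" | s v where "s \<in> M" "s \<in> S" "v \<in> M" "v \<in> V"
    using assms(2) by blast
  then show ?thesis
  proof cases
    case 1
    then have "card M \<le> 1" using module_within_V[OF assms(2,3)] fin by blast
    then have "M = {} \<or> (\<exists>v. M = {v})" using fin
      by (metis One_nat_def card_0_eq card_1_singletonE le_SucE le_zero_eq)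
    then show ?thesis using assms(2) by blast
  next
    case 2
    then have "\<And>s t. s \<in> M \<Longrightarrow> t \<in> M \<Longrightarrow> s = t" using module_within_S[OF assms(2,3)] by blast
    then have "M = {} \<or> (\<exists>v. M = {v})" by blast
    then show ?thesis using assms(2) by blast
  next
    case 3
    then show ?thesis using module_mixed[OF assms(2,3)] by blast
  qed
qed

end

section \<open>Existence of the colouring\<close>

context symmetric_relation
begin

text \<open>Nontrivial twin classes are coloured one by one; every other vertex gets
  \<open>{a}\<close> if it represents a block and \<open>{b}\<close> if not.\<close>

lemma exists_colouring:
  assumes disj: "V \<inter> S = {}" and finS: "finite S" and ab: "a \<in> S" "b \<in> S" "a \<noteq> b"
    and small: "\<And>x. x \<in> V \<Longrightarrow> card (twin_class x) < 2 ^ card S"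
    and x0: "x0 \<in> V" "card S \<le> card (twin_class x0)"
    and stable: "\<forall>y \<in> twin_class x0. \<forall>z \<in> twin_class x0. y \<noteq> z \<longrightarrow> \<not> E y z"
  shows "\<exists>f. coloured_relation V E S a b (twin_class x0) f"
proof -
  define C where "C = twin_class x0"
  define stab where "stab D \<longleftrightarrow> (\<forall>y \<in> D. \<forall>z \<in> D. y \<noteq> z \<longrightarrow> \<not> E y z)" for D
  define cliq where "cliq D \<longleftrightarrow> (\<forall>y \<in> D. \<forall>z \<in> D. y \<noteq> z \<longrightarrow> E y z)" for D
  \<comment> \<open>Taking \<open>c = a\<close> yields \<open>{a}\<close>. At most
    \<open>card S\<close> colours are prescribed, so they fit on the class of
    \<open>x0\<close>.\<close>
  define R where "R = (\<lambda>c. {a, c}) ` S"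
  have "card {a, b} \<le> card S" using ab finS by (intro card_mono) auto
  then have S2: "card S \<ge> 2" using ab by simp
  have cardR: "card R \<le> card S" unfolding R_def using finS by (rule card_image_le)
  define good where "good D g \<longleftrightarrow> inj_on g D \<and> g ` D \<subseteq> Pow S \<and>
      (stab D \<longrightarrow> {} \<notin> g ` D \<and> {a, b} \<in> g ` D \<and> (D = C \<longrightarrow> R \<subseteq> g ` D)) \<and>
      (cliq D \<longrightarrow> S \<notin> g ` D \<and> {b} \<in> g ` D)" for D g
  have ex: "\<exists>g. good (twin_class x) g" if x: "x \<in> V" "card (twin_class x) \<ge> 2" for x
  proof -
    let ?D = "twin_class x"
    have not_both: "\<not> (stab ?D \<and> cliq ?D)"
    proof
      assume "stab ?D \<and> cliq ?D"
      then have "\<forall>y \<in> ?D. \<forall>z \<in> ?D. y = z" unfolding stab_def cliq_def by blast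
      then have "card ?D \<le> Suc 0" using card_le_Suc0_iff_eq[OF finite_twin_class] by blast
      then show False using x by simp
    qed
    have size: "card (Pow S - {Z}) = 2 ^ card S - 1" if "Z \<subseteq> S" for Z
      using that finS by (simp add: card_Pow)
    have le: "card ?D \<le> 2 ^ card S - 1" using small[OF x(1)] by simp
    show ?thesis
    proof (cases "stab ?D")
      case True
      \<comment> \<open>\<open>R\<close> already contains \<open>{a, b}\<close>, so both branches
        provide this colour.\<close>
      let ?R = "if ?D = C then R else {{a, b}}"
      obtain g where "inj_on g ?D" "g ` ?D \<subseteq> Pow S - {{}}" and R: "?R \<subseteq> g ` ?D"
      proof -
        have "\<exists>g. inj_on g ?D \<and> g ` ?D \<subseteq> Pow S - {{}} \<and> ?R \<subseteq> g ` ?D"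
          using finite_twin_class finS ab le size[of "{}"] cardR x x0(2)
          by (intro exists_inj_on_covering) (auto simp: R_def C_def)
        then show thesis using that by blast
      qed
      moreover have "{a, b} \<in> ?R" using ab unfolding R_def by auto
      then have "{a, b} \<in> g ` ?D" using R by (rule subsetD[rotated])
      moreover have "?D = C \<longrightarrow> R \<subseteq> g ` ?D" using R by (auto split: if_splits)
      ultimately have "good ?D g" using True not_both unfolding good_def by (simp add: subset_Diff_insert)
      then show ?thesis by (rule exI[of "good ?D" g])
    next
      case False
      then have cl: "cliq ?D"
        using twin_class_stable_or_clique[OF x(1)] unfolding stab_def cliq_def by blast
      obtain g where "inj_on g ?D" "g ` ?D \<subseteq> Pow S - {S}" "{{b}} \<subseteq> g ` ?D"
      proof -
        have "\<exists>g. inj_on g ?D \<and> g ` ?D \<subseteq> Pow S - {S} \<and> {{b}} \<subseteq> g ` ?D"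
          using finite_twin_class finS ab le size[of S] x
          by (intro exists_inj_on_covering) auto
        then show thesis using that by blast
      qed
      then have "good ?D g" using False unfolding good_def by (simp add: subset_Diff_insert)
      then show ?thesis by (rule exI[of "good ?D" g])
    qed
  qed
  \<comment> \<open>The choice depends on the set only, so all members of a class use the same
    colouring.\<close>
  define g where "g D = (SOME g. good D g)" for D
  have g: "good (twin_class x) (g (twin_class x))" if "x \<in> V" "card (twin_class x) \<ge> 2" for x
    unfolding g_def using ex[OF that] by (rule someI_ex)
  have ne: "\<And>P. block P \<Longrightarrow> P \<noteq> {}" unfolding block_def by auto
  define pick where "pick P = (SOME p. p \<in> P)" for P :: "'a set"
  have pick: "pick P \<in> P" if "block P" for P
    unfolding pick_def using ne[OF that] some_in_eq by blast
  define Q where "Q = pick ` {P. block P}"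
  \<comment> \<open>Block members have singleton twin classes and so reach the default colours,
    which also keep \<open>f\<close> inside \<open>S\<close> outside \<open>V\<close>.\<close>
  define f where "f v = (if v \<in> V \<and> card (twin_class v) \<ge> 2 then g (twin_class v) v
      else if v \<in> Q then {a} else {b})" for v
  have f_class: "f y = g (twin_class x) y"
    if "x \<in> V" "card (twin_class x) \<ge> 2" "y \<in> twin_class x" for x y
    using that twin_class_eq[OF that(1,3)] twin_class_subset[of x] unfolding f_def by auto
  have f_image: "f ` twin_class x = g (twin_class x) ` twin_class x"
    if "x \<in> V" "card (twin_class x) \<ge> 2" for x
    using f_class[OF that] by (rule image_cong[OF refl])
  have good: "good (twin_class x) f" if "x \<in> V" "card (twin_class x) \<ge> 2" for x
  proof -
    have "inj_on f (twin_class x) \<longleftrightarrow> inj_on (g (twin_class x)) (twin_class x)"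
      by (rule inj_on_cong) (rule f_class[OF that])
    then show ?thesis using g[OF that] unfolding good_def f_image[OF that] by argo
  qed
  have two: "card (twin_class x) \<ge> 2" if "x \<in> V" "y \<in> V" "twins x y" "x \<noteq> y" for x y
  proof -
    have "{x, y} \<subseteq> twin_class x" using that twins_refl unfolding twin_class_def by blast
    then have "card {x, y} \<le> card (twin_class x)" using finite_twin_class card_mono by blast
    then show ?thesis using that by simp
  qed
  have f_block: "f x = (if x = pick P then {a} else {b})" if "block P" "x \<in> P" for x P
  proof -
    have "x \<in> Q \<longleftrightarrow> x = pick P"
      unfolding Q_def using that pick blocks_disjoint by blast
    then show ?thesis unfolding f_def using block_twin_class[OF that] by simp
  qed
  have block_V: "P \<subseteq> V" if "block P" for P using that unfolding block_def rel_module_def by blast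
  have C2: "card (twin_class x0) \<ge> 2" using S2 x0 by simp
  have RC: "R \<subseteq> f ` C" using good[OF x0(1) C2] stable unfolding good_def C_def stab_def by blast
  have "coloured_relation V E S a b C f"
  proof unfold_locales
    show "f x \<subseteq> S" for x
    proof (cases "x \<in> V \<and> card (twin_class x) \<ge> 2")
      case True
      then show ?thesis using good[of x] twin_class_self[of x] unfolding good_def by blast
    next
      case False
      then show ?thesis unfolding f_def using ab by auto
    qed
    show "C \<subseteq> V" "rel_module C" unfolding C_def using twin_class_subset twin_class_module x0 by blast+
    show "\<And>x y. x \<in> C \<Longrightarrow> y \<in> C \<Longrightarrow> x \<noteq> y \<Longrightarrow> \<not> E x y" using stable unfolding C_def by blast
    have "{a} \<in> R" unfolding R_def using ab by auto
    then show "\<exists>x \<in> C. f x = {a}" using RC by (metis imageE subsetD)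
    show "\<exists>x \<in> C. f x = {a, c}" if "c \<in> S" for c
    proof -
      have "{a, c} \<in> R" unfolding R_def using that by auto
      then show ?thesis using RC by (metis imageE subsetD)
    qed
    fix x assume x: "x \<in> V"
    note self = twin_class_self[OF x]
    {
      fix y assume y: "y \<in> V" "twins x y"
      then have yD: "y \<in> twin_class x" unfolding twin_class_def by blast
      show "x = y" if "f x = f y"
      proof (rule ccontr)
        assume "x \<noteq> y"
        then have "inj_on f (twin_class x)" using good[OF x two[OF x y]] unfolding good_def by blast
        then show False using that self yD \<open>x \<noteq> y\<close> unfolding inj_on_def by blast
      qed
      have kind: "stab (twin_class x) \<or> cliq (twin_class x)"
        using twin_class_stable_or_clique[OF x] unfolding stab_def cliq_def by blast
      assume xy: "x \<noteq> y"
      note gd = good[OF x two[OF x y xy]]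
      show "f x \<noteq> {} \<and> (\<exists>z \<in> V. twins x z \<and> f z = {a, b})" if "\<not> E x y"
      proof -
        have "stab (twin_class x)" using kind that xy self yD unfolding cliq_def by blast
        then have 1: "{} \<notin> f ` twin_class x" "{a, b} \<in> f ` twin_class x" using gd unfolding good_def by blast+
        from 1(2) obtain z where "z \<in> twin_class x" "f z = {a, b}" by (metis imageE)
        then show ?thesis using 1(1) self unfolding twin_class_def by (metis (no_types, lifting) image_eqI mem_Collect_eq)
      qed
      show "f x \<noteq> S \<and> (\<exists>z \<in> V. twins x z \<and> f z = {b})" if "E x y"
      proof -
        have "cliq (twin_class x)" using kind that xy self yD unfolding stab_def by blast
        then have 1: "S \<notin> f ` twin_class x" "{b} \<in> f ` twin_class x" using gd unfolding good_def by blast+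
        from 1(2) obtain z where "z \<in> twin_class x" "f z = {b}" by (metis imageE)
        then show ?thesis using 1(1) self unfolding twin_class_def by (metis (no_types, lifting) image_eqI mem_Collect_eq)
      qed
    }
    assume "\<And>y. y \<in> V \<Longrightarrow> twins x y \<Longrightarrow> y = x"
    then have tx: "twin_class x = {x}" using self unfolding twin_class_def by blast
    show "f x = {b} \<or> f x = {a} \<and> (\<exists>q \<in> V. q \<noteq> x \<and> E q x \<and> f q = {b})"
    proof (cases "x \<in> Q")
      case True
      then obtain P where P: "block P" "x = pick P" unfolding Q_def by blast
      then obtain q where "q \<in> P" "q \<noteq> x" "E q x" using block_neighbour pick by blast
      then have "f q = {b}" "q \<in> V" using f_block[OF P(1)] P block_V by auto
      then show ?thesis using \<open>q \<noteq> x\<close> \<open>E q x\<close> f_block[OF P(1) pick[OF P(1)]] P by auto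
    next
      case False
      then show ?thesis unfolding f_def tx by simp
    qed
  next
    fix P assume P: "block P"
    obtain q where "q \<in> P" "q \<noteq> pick P" using block_neighbour[OF P pick[OF P]] by blast
    then have "f q = {b}" "f (pick P) = {a}" using f_block[OF P] pick[OF P] by auto
    then show "\<exists>x \<in> P. \<exists>y \<in> P. f x \<noteq> f y"
      using \<open>q \<in> P\<close> pick[OF P] ab by (metis the_elem_eq)
  qed (use disj ab in auto)
  then show ?thesis unfolding C_def by blast
qed

lemma exists_extension:
  assumes "V \<inter> S = {}" "finite S" "card S \<ge> 2"
    and "\<And>x. x \<in> V \<Longrightarrow> card (twin_class x) < 2 ^ card S"
    and "x0 \<in> V" "card S \<le> card (twin_class x0)"
    and "\<forall>y \<in> twin_class x0. \<forall>z \<in> twin_class x0. y \<noteq> z \<longrightarrow> \<not> E y z"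
  shows "\<exists>F. (\<forall>x y. F x y \<longleftrightarrow> F y x) \<and> (\<forall>x \<in> V. \<forall>y \<in> V. F x y \<longleftrightarrow> E x y) \<and>
    (\<forall>M \<subseteq> V \<union> S. (\<forall>v \<in> V \<union> S - M. (\<forall>x \<in> M. F v x) \<or> (\<forall>x \<in> M. \<not> F v x)) \<longrightarrow>
       M = {} \<or> M = V \<union> S \<or> (\<exists>v \<in> V \<union> S. M = {v}))"
proof -
  obtain a b where ab: "a \<in> S" "b \<in> S" "a \<noteq> b"
    using assms(2,3) card_le_Suc0_iff_eq[of S] by fastforce
  obtain f where "coloured_relation V E S a b (twin_class x0) f"
    using exists_colouring[OF assms(1,2) ab assms(4-7)] by blast
  then interpret coloured_relation V E S a b "twin_class x0" f .
  show ?thesis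
    using ext_sym ext_VV ext_module_trivial[OF assms(2)] by (intro exI[of _ ext]) blast
qed

end

section \<open>Prime extensions of graphs\<close>

text \<open>Removing the diagonal of \<open>F\<close> makes the graph loop-free and leaves modules
  unchanged, as these only compare a vertex outside \<open>M\<close> with vertices inside.\<close>

lemma exists_prime_extension:
  fixes G :: "'a::infinite pair_pre_digraph"
  assumes G: "pair_graph G" and k: "k \<ge> 2"
    and F_sym: "\<And>x y. F x y \<longleftrightarrow> F y x"
    and F_G: "\<And>x y. x \<in> pverts G \<Longrightarrow> y \<in> pverts G \<Longrightarrow> x \<noteq> y \<Longrightarrow> F x y \<longleftrightarrow> (x, y) \<in> parcs G"
    and S: "pverts G \<inter> S = {}" "finite S" "card S = k" "card (pverts G) \<ge> 2"
    and triv: "\<And>M. M \<subseteq> pverts G \<union> S \<Longrightarrow>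
      (\<forall>v \<in> pverts G \<union> S - M. (\<forall>x \<in> M. F v x) \<or> (\<forall>x \<in> M. \<not> F v x)) \<Longrightarrow>
       M = {} \<or> M = pverts G \<union> S \<or> (\<exists>v \<in> pverts G \<union> S. M = {v})"
  shows "\<exists>H. p_extension k G H \<and> prime_graph H"
proof -
  interpret G: pair_graph G by fact
  let ?W = "pverts G \<union> S"
  define H where "H = \<lparr>pverts = ?W, parcs = {(x, y). x \<in> ?W \<and> y \<in> ?W \<and> x \<noteq> y \<and> F x y}\<rparr>"
  have H: "pverts H = ?W" "\<And>x y. (x, y) \<in> parcs H \<longleftrightarrow> x \<in> ?W \<and> y \<in> ?W \<and> x \<noteq> y \<and> F x y"
    unfolding H_def by auto
  have finW: "finite ?W" using S G.pair_finite_verts by blast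
  have "parcs H \<subseteq> ?W \<times> ?W" using H by auto
  then have fina: "finite (parcs H)" using finW finite_subset by blast
  have "symmetric (with_proj H)"
    unfolding symmetric_def with_proj_simps by (rule symI) (use H F_sym in blast)
  then have "pair_graph H"
    by unfold_locales (use finW fina H in auto)
  moreover have "with_proj H \<restriction> pverts G = with_proj G"
  proof -
    have "{e \<in> parcs H. fst e \<in> pverts G \<and> snd e \<in> pverts G} = parcs G"
      using H F_G G.in_arcsD1 G.in_arcsD2 G.pair_no_loops by fastforce
    then show ?thesis unfolding induce_subgraph_def by (simp add: with_proj_def)
  qed
  moreover have "pverts H - pverts G = S" using H S by blast
  ultimately have "p_extension k G H"
    unfolding p_extension_def graph_extension_def using H S by auto
  moreover have "prime_graph H"
    unfolding prime_graph_def
  proof (intro conjI allI impI)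
    show "card (pverts H) \<ge> 4"
      using H S k G.pair_finite_verts by (simp add: card_Un_disjoint)
    fix M assume M: "graph_module H M"
    then have "M \<subseteq> ?W" unfolding graph_module_def H by blast
    moreover have "\<forall>v \<in> ?W - M. (\<forall>x \<in> M. F v x) \<or> (\<forall>x \<in> M. \<not> F v x)"
    proof
      fix v assume v: "v \<in> ?W - M"
      then have "(\<forall>x \<in> M. (v, x) \<in> parcs H) \<or> (\<forall>x \<in> M. (v, x) \<notin> parcs H)"
        using M unfolding graph_module_def H(1) by blast
      moreover have "(v, x) \<in> parcs H \<longleftrightarrow> F v x" if "x \<in> M" for x
        using H(2) v that \<open>M \<subseteq> ?W\<close> by blast
      ultimately show "(\<forall>x \<in> M. F v x) \<or> (\<forall>x \<in> M. \<not> F v x)" by blast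
    qed
    ultimately show "trivial_module H M" using triv unfolding trivial_module_def H by blast
  qed
  ultimately show ?thesis by blast
qed

text \<open>The colouring is applied to the twin class containing \<open>M0\<close>, in
  \<open>G\<close> or its complement; the bound on modules limits every twin class to
  \<open>m < 2 ^ k\<close> elements.\<close>

lemma prime_bound_le:
  fixes G :: "'a::infinite pair_pre_digraph"
  assumes G: "pair_graph G" and k: "k \<ge> 2" "k \<le> m" "m < 2 ^ k"
    and bound: "\<And>M. graph_module G M \<Longrightarrow> stable_set G M \<or> clique_set G M \<Longrightarrow> card M \<le> m"
    and M0: "graph_module G M0" "card M0 = m" "stable_set G M0 \<or> clique_set G M0"
  shows "prime_bound G \<le> k"
proof -
  interpret G: pair_graph G by fact
  let ?V = "pverts G"
  \<comment> \<open>the complement of \<open>G\<close> if \<open>M0\<close> is a clique\<close>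
  define E where "E x y \<longleftrightarrow> (stable_set G M0 \<longleftrightarrow> (x, y) \<in> parcs G)" for x y
  have arc_sym: "(x, y) \<in> parcs G \<longleftrightarrow> (y, x) \<in> parcs G" for x y
    using G.pair_sym_arcs unfolding symmetric_def by (auto dest: symD)
  interpret symmetric_relation ?V E
    using G.pair_finite_verts arc_sym by unfold_locales (auto simp: E_def)
  have mod: "rel_module M \<longleftrightarrow> graph_module G M" for M
    unfolding rel_module_def graph_module_def E_def by (cases "stable_set G M0") auto
  have M0_V: "M0 \<subseteq> ?V" using M0 unfolding graph_module_def by blast
  have M0_stable: "\<not> E x y" if "x \<in> M0" "y \<in> M0" "x \<noteq> y" for x y
    using M0(3) that unfolding E_def stable_set_def clique_set_def by blast
  have small: "card (twin_class x) \<le> m" if "x \<in> ?V" for x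
  proof (rule bound)
    show "graph_module G (twin_class x)" using twin_class_module[OF that] mod by blast
    show "stable_set G (twin_class x) \<or> clique_set G (twin_class x)"
      using twin_class_stable_or_clique[OF that] twin_class_subset[of x]
      unfolding E_def stable_set_def clique_set_def by blast
  qed
  have finM0: "finite M0" using M0_V G.pair_finite_verts finite_subset by blast
  have "m \<ge> 2" using k by simp
  then obtain x y where xy: "x \<in> M0" "y \<in> M0" "x \<noteq> y"
    using card_le_Suc0_iff_eq[OF finM0] M0(2) by fastforce
  \<comment> \<open>A vertex in \<open>M0\<close> sees no other member by stability; one outside
    sees all or none.\<close>
  have twin: "M0 \<subseteq> twin_class x"
  proof
    fix z assume z: "z \<in> M0"
    have "twins x z"
      unfolding twins_def
    proof
      fix v assume v: "v \<in> ?V - {x, z}"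
      show "E v x \<longleftrightarrow> E v z"
      proof (cases "v \<in> M0")
        case True
        then show ?thesis using M0_stable v xy z by blast
      next
        case False
        then show ?thesis using rel_moduleD[of M0 v x z] mod M0 v xy z by blast
      qed
    qed
    then show "z \<in> twin_class x" using z M0_V unfolding twin_class_def by blast
  qed
  have xV: "x \<in> ?V" using xy M0_V by blast
  have stable: "\<forall>y \<in> twin_class x. \<forall>z \<in> twin_class x. y \<noteq> z \<longrightarrow> \<not> E y z"
    using twin_class_stable_or_clique[OF xV] M0_stable xy twin by blast
  have big: "k \<le> card (twin_class x)"
    using card_mono[OF finite_twin_class twin] M0(2) k by simp
  have cardV: "card ?V \<ge> 2" using card_mono[OF G.pair_finite_verts M0_V] M0(2) \<open>m \<ge> 2\<close> by simp
  have "infinite (UNIV - ?V)" using G.pair_finite_verts infinite_UNIV by simp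
  then obtain S where S: "finite S" "card S = k" "S \<subseteq> UNIV - ?V"
    using infinite_arbitrarily_large by blast
  have disj: "?V \<inter> S = {}" using S by blast
  have lt: "card (twin_class x) < 2 ^ card S" if "x \<in> ?V" for x
    using small[OF that] k S by simp
  obtain F where F: "\<forall>x y. F x y \<longleftrightarrow> F y x" "\<forall>x \<in> ?V. \<forall>y \<in> ?V. F x y \<longleftrightarrow> E x y"
    "\<forall>M \<subseteq> ?V \<union> S. (\<forall>v \<in> ?V \<union> S - M. (\<forall>x \<in> M. F v x) \<or> (\<forall>x \<in> M. \<not> F v x)) \<longrightarrow>
       M = {} \<or> M = ?V \<union> S \<or> (\<exists>v \<in> ?V \<union> S. M = {v})"
    using exists_extension[OF disj S(1) _ lt xV _ stable] k big S by blast
  \<comment> \<open>Complements back when \<open>M0\<close> is not stable; modules are the same for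
    \<open>F\<close> and \<open>F'\<close>.\<close>
  define F' where "F' x y \<longleftrightarrow> (stable_set G M0 \<longleftrightarrow> F x y)" for x y
  have "\<exists>H. p_extension k G H \<and> prime_graph H"
  proof (rule exists_prime_extension[OF G k(1) _ _ disj S(1,2) cardV])
    show "F' x y \<longleftrightarrow> F' y x" for x y unfolding F'_def using F(1) by blast
    show "F' x y \<longleftrightarrow> (x, y) \<in> parcs G" if "x \<in> ?V" "y \<in> ?V" for x y
      unfolding F'_def using F(2) that E_def by blast
    fix M assume "M \<subseteq> ?V \<union> S" "\<forall>v \<in> ?V \<union> S - M. (\<forall>x \<in> M. F' v x) \<or> (\<forall>x \<in> M. \<not> F' v x)"
    moreover from this have "\<forall>v \<in> ?V \<union> S - M. (\<forall>x \<in> M. F v x) \<or> (\<forall>x \<in> M. \<not> F v x)"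
      unfolding F'_def by blast
    ultimately show "M = {} \<or> M = ?V \<union> S \<or> (\<exists>v \<in> ?V \<union> S. M = {v})" using F(3) by blast
  qed
  then show ?thesis unfolding prime_bound_def by (rule Least_le)
qed

theorem theorem2:
  fixes G :: "'a::infinite pair_pre_digraph"
  assumes "pair_graph G"
    and "max (modular_stability_number G) (modular_clique_number G) \<ge> 2"
  shows "int (prime_bound G) \<le>
    \<lceil>log 2 (real (max (modular_stability_number G) (modular_clique_number G)) + 1)\<rceil>"
proof -
  interpret G: pair_graph G by fact
  let ?A = "{M. graph_module G M \<and> stable_set G M}"
  let ?B = "{M. graph_module G M \<and> clique_set G M}"
  define m where "m = max (modular_stability_number G) (modular_clique_number G)"
  define k where "k = nat \<lceil>log 2 (real m + 1)\<rceil>"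
  have m2: "m \<ge> 2" using assms(2) unfolding m_def .
  have "?A \<subseteq> Pow (pverts G)" "?B \<subseteq> Pow (pverts G)" unfolding graph_module_def by blast+
  then have fin: "finite (card ` ?A)" "finite (card ` ?B)"
    using G.pair_finite_verts by (meson finite_Pow_iff finite_imageI finite_subset)+
  \<comment> \<open>The empty module makes both maxima range over nonempty sets, so they are
    attained.\<close>
  have "{} \<in> ?A" "{} \<in> ?B" unfolding graph_module_def stable_set_def clique_set_def by auto
  then have ne: "card ` ?A \<noteq> {}" "card ` ?B \<noteq> {}" by blast+
  have bound: "card M \<le> m" if "graph_module G M" "stable_set G M \<or> clique_set G M" for M
    unfolding m_def modular_stability_number_def modular_clique_number_def
    using that Max_ge[OF fin(1), of "card M"] Max_ge[OF fin(2), of "card M"] by (auto simp: le_max_iff_disj)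
  have "m \<in> card ` ?A \<union> card ` ?B"
    using Max_in[OF fin(1) ne(1)] Max_in[OF fin(2) ne(2)]
    unfolding m_def modular_stability_number_def modular_clique_number_def max_def by auto
  then obtain M0 where M0: "graph_module G M0" "card M0 = m" "stable_set G M0 \<or> clique_set G M0"
    by blast
  have pos: "log 2 (real m + 1) > 1" using m2 by simp
  then have ceil: "int k = \<lceil>log 2 (real m + 1)\<rceil>" unfolding k_def by linarith
  have k_ge: "log 2 (real m + 1) \<le> real k" using ceil by linarith
  have "k \<ge> 2" using k_ge pos by linarith
  moreover have "k \<le> m"
  proof -
    \<comment> \<open>The strict bound \<open>m < 2 ^ m\<close> absorbs the \<open>+ 1\<close> under
      the logarithm.\<close>
    have "m + 1 \<le> 2 ^ m" using less_exp[of m] by linarith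
    then have "real (m + 1) \<le> real (2 ^ m)" by (rule of_nat_mono)
    then have "real m + 1 \<le> 2 powr real m" by (simp add: powr_realpow)
    then have "log 2 (real m + 1) \<le> real m" by (simp add: log_le_iff)
    then have "\<lceil>log 2 (real m + 1)\<rceil> \<le> int m" by (simp add: ceiling_le_iff)
    then show ?thesis using ceil by simp
  qed
  moreover have "m < 2 ^ k"
  proof -
    have "real m + 1 \<le> 2 powr real k" using k_ge by (simp add: log_le_iff)
    then have "real m + 1 \<le> real (2 ^ k)" by (simp add: powr_realpow)
    then have "real m < real (2 ^ k)" by linarith
    then show ?thesis by (simp only: of_nat_less_iff)
  qed
  ultimately have "prime_bound G \<le> k" using prime_bound_le[OF assms(1) _ _ _ bound M0] by blast
  then show ?thesis using ceil unfolding m_def by simp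
qed

end
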